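(* For any $\boldsymbol x\in\mathcal Z^2$, $$\mathbb P(\tau_\ell(\boldsymbol x)=n)=\frac{\ell}{2n}\binom{2n}{n+\ell/2}\frac1{4^n},\qquad n\in\mathbb N.$$ In particular, for any $f$ satisfying $\ell^2/f(\ell)\to0$ as $\ell\to\infty$, $$\lim_{\ell\to\infty}\frac{f(\ell)^{3/2}}{\ell}\,\mathbb P\big(\tau_\ell(\boldsymbol x)=\lfloor f(\ell)\rfloor\big)=\frac1{2\sqrt\pi}\qquad\text{and}\qquad \lim_{\ell\to\infty}\frac{\sqrt{f(\ell)}}{\ell}\,\mathbb P\big(\tau_\ell(\boldsymbol x)\ge f(\ell)\big)=\frac1{4\sqrt\pi}.$$
   Context: Let $\mathcal Z^2=\{(x_1,x_2)\in\mathbb Z^2: x_1+x_2\in 2\mathbb Z\}$, and let $\{\xi_{\boldsymbol x}:\boldsymbol x\in\mathcal Z^2\}$ be independent Bernoulli$(1/2)$ random variables. From each node $\boldsymbol x=(x_1,x_2)\in\mathcal Z^2$ draw one directed edge: to $(x_1-1,x_2+1)$ if $\xi_{\boldsymbol x}=1$, and to $(x_1-1,x_2-1)$ if $\xi_{\boldsymbol x}=0$. Each node of $\mathcal Z^2$ initially carries a unit amount of traffic, which flows along the directed edges towards the left. For $\ell>0$ and $\boldsymbol x=(x_1,x_2)$ let $I_\ell(\boldsymbol x)=\{x_1\}\times[x_2-\ell/2,x_2+\ell/2]$ (the slit). $\tau_\ell(\boldsymbol x)$ denotes the number of points in the longest directed path that carries traffic flowing through the slit $I_\ell(\boldsymbol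 x)$.
   Formalization: The exact law is stated only for ℓ/2 an odd positive integer (it fails for ℓ=4, n=2, and the binomial is undefined for non-integer ℓ/2), f is assumed eventually positive, and the last limit is corrected from 1/(4√π) to 1/√π, the value implied by the first two displays. *)

theory Defs
  imports "HOL-Probability.Probability"
begin

definition even_lattice :: "(int \<times> int) set" where
  "even_lattice = {(a, b). even (a + b)}"

text \<open>An environment assigns to each node the value of its Bernoulli variable
  (\<open>True\<close> for 1, \<open>False\<close> for 0); \<open>out_edge\<close> gives the endpoint of the unique
  edge leaving a node.\<close>

definition out_edge :: "(int \<times> int \<Rightarrow> bool) \<Rightarrow> int \<times> int \<Rightarrow> int \<times> int" where
  "out_edge w u = (fst u - 1, if w u then snd u + 1 else snd u - 1)"

text \<open>Paths are nonempty lists of nodes, listed in the direction of the flow (right to left).\<close>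

definition directed_path :: "(int \<times> int \<Rightarrow> bool) \<Rightarrow> (int \<times> int) list \<Rightarrow> bool" where
  "directed_path w p \<longleftrightarrow>
     p \<noteq> [] \<and> set p \<subseteq> even_lattice \<and> successively (\<lambda>u v. v = out_edge w u) p"

text \<open>The slit is closed. It contains \<open>2 * \<lfloor>l / 4\<rfloor> + 1\<close> nodes if \<open>l > 0\<close> and its centre is a
  node; this number is \<open>l / 2\<close> exactly when \<open>l / 2\<close> is an odd integer.\<close>

definition slit :: "real \<Rightarrow> int \<times> int \<Rightarrow> (real \<times> real) set" where
  "slit l x = {real_of_int (fst x)} \<times> {real_of_int (snd x) - l / 2 .. real_of_int (snd x) + l / 2}"

text \<open>A path carries traffic through the slit by flowing into it, so it is followed up to its node
  on the slit (which is counted); the continuation to the left, which never ends, is not part of it.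
  The value is \<open>\<infinity>\<close> if there are arbitrarily long such paths.\<close>

definition tau :: "real \<Rightarrow> int \<times> int \<Rightarrow> (int \<times> int \<Rightarrow> bool) \<Rightarrow> enat" where
  "tau l x w =
     (SUP p \<in> {p. directed_path w p \<and>
                   (real_of_int (fst (last p)), real_of_int (snd (last p))) \<in> slit l x}.
        enat (length p))"

end

theory Submission
  imports Defs "HOL-Real_Asymp.Real_Asymp"
begin

text \<open>
  The nodes of a slit are \<open>m = 2 * \<lfloor>l / 4\<rfloor> + 1\<close> consecutive nodes of one column. If the nodes of column
  \<open>c\<close> that feed the slit are \<open>N > 0\<close> consecutive nodes, then in column \<open>c + 1\<close> the \<open>N - 1\<close> nodes strictly
  between their heights feed it whatever their bits are, and the node above the top and the node
  below the bottom feed it with probability \<open>1 / 2\<close> each. So the feeding nodes are again consecutive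
  (\<open>out_edge_preimage_column_interval\<close>), and their number performs a walk with steps \<open>- 1, 0, 1\<close> of
  probabilities \<open>1 / 4, 1 / 2, 1 / 4\<close>, stopped at 0; such a step is half the sum of two independent fair
  signs. The longest path has at least \<open>n + 1\<close> nodes exactly if this walk, started from \<open>m\<close>, is still
  positive after \<open>n\<close> steps (\<open>tau_ge_iff_survives\<close>).

  By the reflection principle, the survival probability is the probability that the free walk ends
  in \<open>{- m + 1..m}\<close>. Pairing the two ends of this interval turns it into \<open>upper_binomials n m / 4 ^ n\<close>, a
  form whose recursion is Pascal's rule together with the symmetry of the odd rows (\<open>upper_binomials_Suc\<close>).
  Differences of consecutive survival probabilities give the exact law (\<open>prob_tau_eq\<close>).

  For the limits, the ratio of \<open>(2 * n) choose (n + m)\<close> to the central coefficient \<open>(2 * n) choose n\<close> lies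
  between \<open>1 - m\<^sup>2 / n\<close> and 1, and \<open>m\<^sup>2 / n\<close> tends to 0 as it has the order of \<open>l\<^sup>2 / f l\<close>. Hence every
  binomial coefficient that occurs may be replaced by the central one, whose size is given by the
  Wallis product. The tail is itself a sum of \<open>2 * m\<close> such coefficients, so its limit comes
  from this comparison too, without summing the point probabilities.
\<close>

section \<open>The nodes that feed a slit\<close>

text \<open>The \<open>N\<close> consecutive lattice nodes of column \<open>c\<close> whose lowest height is \<open>a\<close>. The inequalities are over \<open>int\<close>
  so that membership stays linear arithmetic with parity.\<close>

definition column_interval :: "int \<Rightarrow> int \<Rightarrow> nat \<Rightarrow> (int \<times> int) set" where
  "column_interval c a N =
     {z. fst z = c \<and> even (snd z - a) \<and> a \<le> snd z \<and> snd z < a + 2 * int N}"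

lemma out_edge_even_lattice: "z \<in> even_lattice \<Longrightarrow> out_edge w z \<in> even_lattice"
  by (cases z) (auto simp: even_lattice_def out_edge_def)

text \<open>Only the two extreme candidates, at the heights \<open>a - 1\<close> and \<open>a + 2 * N - 1\<close>, depend on their bit: the
  former must step up and the latter down. A node between them lands in the interval either way.
  If \<open>N = 0\<close>, the two candidates would be the same node and the count would be wrong.\<close>

lemma out_edge_preimage_column_interval:
  assumes "even (c + a)" "N > 0"
  shows "{z \<in> even_lattice. out_edge w z \<in> column_interval c a N} =
    column_interval (c + 1) (if w (c + 1, a - 1) then a - 1 else a + 1)
      (N - 1 + of_bool (w (c + 1, a - 1)) + of_bool (\<not> w (c + 1, a + 2 * int N - 1)))"
    (is "?L = ?R")
proof -
  have "(s, y) \<in> ?L \<longleftrightarrow> (s, y) \<in> ?R" for s y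
  proof (cases "s = c + 1")
    case False
    then show ?thesis by (auto simp: column_interval_def out_edge_def)
  next
    case s: True
    show ?thesis
    proof (cases "even (y - a)")
      case True
      then show ?thesis using assms(1)
        by (auto simp: column_interval_def out_edge_def even_lattice_def s)
    next
      case odd: False
      then obtain k where k: "y = a + 2 * k + 1"
        by (metis add_diff_cancel_left' diff_add_cancel oddE add.assoc)
      have ev: "even (s + y)" using assms(1) by (simp add: s k)
      consider "y = a - 1" | "y = a + 2 * int N - 1" | "y \<noteq> a - 1" "y \<noteq> a + 2 * int N - 1"
        by blast
      then show ?thesis
      proof cases
        case 1
        with \<open>N > 0\<close> ev show ?thesis
          by (auto simp: column_interval_def out_edge_def even_lattice_def s)
      next
        case 2
        with \<open>N > 0\<close> ev show ?thesis
          by (auto simp: column_interval_def out_edge_def even_lattice_def s)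
      next
        case 3
        with \<open>N > 0\<close> ev k show ?thesis
          by (auto simp: column_interval_def out_edge_def even_lattice_def s)
      qed
    qed
  qed
  then show ?thesis by (intro set_eqI) (simp only: split_paired_all)
qed

text \<open>The walk of the feeding intervals, read off the environment column by column to the right:
  the interval with lowest height \<open>a\<close> and \<open>N\<close> nodes in column \<open>c\<close> is still fed from column \<open>c + n\<close>.\<close>

primrec survives ::
    "(int \<times> int \<Rightarrow> bool) \<Rightarrow> nat \<Rightarrow> int \<Rightarrow> int \<Rightarrow> nat \<Rightarrow> bool" where
  "survives w 0 c a N \<longleftrightarrow> N > 0"
| "survives w (Suc n) c a N \<longleftrightarrow> N > 0 \<and>
     survives w n (c + 1) (if w (c + 1, a - 1) then a - 1 else a + 1)
       (N - 1 + of_bool (w (c + 1, a - 1)) + of_bool (\<not> w (c + 1, a + 2 * int N - 1)))"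

lemma directed_path_snoc:
  assumes "p \<noteq> []"
  shows "directed_path w (p @ [y]) \<longleftrightarrow> directed_path w p \<and> y = out_edge w (last p)"
  using assms
  by (auto simp: directed_path_def successively_append_iff intro!: out_edge_even_lattice)

text \<open>Cutting off the start of a path keeps its end, so a slit that is reached by a long path is also
  reached by a path of each smaller positive length.\<close>

lemma directed_path_drop:
  assumes "directed_path w p" "i < length p"
  shows "directed_path w (drop i p)"
proof -
  have "successively (\<lambda>u v. v = out_edge w u) (take i p @ drop i p)"
    using assms by (simp add: directed_path_def)
  then have "successively (\<lambda>u v. v = out_edge w u) (drop i p)"
    by (simp only: successively_append_iff)
  with assms show ?thesis
    unfolding directed_path_def by (auto dest: in_set_dropD)
qed

text \<open>Peeling the last node off a path moves the target one column to the right, which is the direction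
  in which \<open>survives\<close> recurses.\<close>

lemma ex_path_Suc_iff:
  "(\<exists>p. directed_path w p \<and> length p = Suc (Suc n) \<and> last p \<in> D) \<longleftrightarrow>
   (\<exists>p. directed_path w p \<and> length p = Suc n \<and> last p \<in> {z \<in> even_lattice. out_edge w z \<in> D})"
  (is "?L \<longleftrightarrow> ?R")
proof
  assume ?L
  then obtain p where p: "directed_path w p" "length p = Suc (Suc n)" "last p \<in> D" by blast
  then obtain q y where q: "p = q @ [y]" "q \<noteq> []"
    by (metis append_butlast_last_id length_0_conv length_butlast diff_Suc_1 nat.distinct(1))
  with p(1) have "directed_path w q" "y = out_edge w (last q)"
    by (simp_all add: directed_path_snoc)
  moreover from this q have "last q \<in> even_lattice"
    by (auto simp: directed_path_def)
  ultimately show ?R using p q by auto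
next
  assume ?R
  then obtain p where p: "directed_path w p" "length p = Suc n" "out_edge w (last p) \<in> D"
    by blast
  then have "directed_path w (p @ [out_edge w (last p)])"
    by (subst directed_path_snoc) auto
  with p show ?L by (intro exI[of _ "p @ [out_edge w (last p)]"]) auto
qed

lemma survives_iff_ex_path:
  assumes "even (c + a)"
  shows "survives w n c a N \<longleftrightarrow>
    (\<exists>p. directed_path w p \<and> length p = Suc n \<and> last p \<in> column_interval c a N)"
  using assms
proof (induction n arbitrary: c a N)
  case 0
  show ?case
  proof
    assume "survives w 0 c a N"
    with 0 show "\<exists>p. directed_path w p \<and> length p = Suc 0 \<and> last p \<in> column_interval c a N"
      by (intro exI[of _ "[(c, a)]"])
        (auto simp: directed_path_def column_interval_def even_lattice_def)
  qed (auto simp: column_interval_def)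
next
  case (Suc n)
  show ?case
  proof (cases "N = 0")
    case True
    then show ?thesis by (auto simp: column_interval_def)
  next
    case False
    show ?thesis
      unfolding ex_path_Suc_iff out_edge_preimage_column_interval[OF Suc.prems False[unfolded neq0_conv]]
        survives.simps
      by (subst Suc.IH) (use False Suc.prems in auto)
  qed
qed

text \<open>A lattice node in the column of the centre has height \<open>snd x + 2 * i\<close>, and it lies on the slit if and only
  if \<open>\<bar>i\<bar> \<le> l / 4\<close>.\<close>

lemma even_lattice_slit_iff:
  assumes x: "x \<in> even_lattice" and l: "l > 0" and z: "z \<in> even_lattice"
  shows "(real_of_int (fst z), real_of_int (snd z)) \<in> slit l x \<longleftrightarrow>
    z \<in> column_interval (fst x) (snd x - 2 * \<lfloor>l / 4\<rfloor>) (2 * nat \<lfloor>l / 4\<rfloor> + 1)"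
proof (cases "fst z = fst x")
  case False
  then show ?thesis by (simp add: slit_def column_interval_def)
next
  case True
  with x z have "even (snd z - snd x)"
    by (auto simp: even_lattice_def split: prod.splits)
  then obtain i where i: "snd z = snd x + 2 * i"
    by (metis add.commute diff_add_cancel dvdE)
  have nn: "0 \<le> \<lfloor>l / 4\<rfloor>" using l by simp
  have "(real_of_int (fst z), real_of_int (snd z)) \<in> slit l x \<longleftrightarrow>
      real_of_int i \<le> l / 4 \<and> real_of_int (- i) \<le> l / 4"
    using True by (auto simp: slit_def i)
  also have "\<dots> \<longleftrightarrow> i \<le> \<lfloor>l / 4\<rfloor> \<and> - i \<le> \<lfloor>l / 4\<rfloor>"
    by (simp only: le_floor_iff)
  also have "\<dots> \<longleftrightarrow> z \<in> column_interval (fst x) (snd x - 2 * \<lfloor>l / 4\<rfloor>) (2 * nat \<lfloor>l / 4\<rfloor> + 1)"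
    using True nn by (auto simp: column_interval_def i)
  finally show ?thesis .
qed

text \<open>The supremum in \<open>tau\<close> may be infinite, but it is at least \<open>Suc n\<close> only if some path has at least that
  many nodes; shortening this path from its start gives one with exactly \<open>Suc n\<close> nodes.\<close>

lemma tau_ge_iff_survives:
  assumes x: "x \<in> even_lattice" and l: "l > 0"
  shows "enat (Suc n) \<le> tau l x w \<longleftrightarrow>
    survives w n (fst x) (snd x - 2 * \<lfloor>l / 4\<rfloor>) (2 * nat \<lfloor>l / 4\<rfloor> + 1)"
    (is "_ \<longleftrightarrow> survives w n ?c ?a ?N")
proof -
  let ?P = "{p. directed_path w p \<and>
    (real_of_int (fst (last p)), real_of_int (snd (last p))) \<in> slit l x}"
  have P: "p \<in> ?P \<longleftrightarrow> directed_path w p \<and> last p \<in> column_interval ?c ?a ?N" for p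
  proof (cases "directed_path w p")
    case True
    then have "last p \<in> even_lattice" by (auto simp: directed_path_def)
    with True show ?thesis using even_lattice_slit_iff[OF x l] by simp
  qed simp
  have "enat (Suc n) \<le> tau l x w \<longleftrightarrow> (\<exists>p\<in>?P. length p = Suc n)"
  proof
    assume "\<exists>p\<in>?P. length p = Suc n"
    then show "enat (Suc n) \<le> tau l x w"
      unfolding tau_def by (metis (mono_tags, lifting) SUP_upper)
  next
    assume ge: "enat (Suc n) \<le> tau l x w"
    have "\<exists>p\<in>?P. Suc n \<le> length p"
    proof (rule ccontr)
      assume "\<not> ?thesis"
      then have "tau l x w \<le> enat n"
        unfolding tau_def by (intro SUP_least) force
      with ge have "enat (Suc n) \<le> enat n" by (rule order_trans)
      then show False by simp
    qed
    then obtain p where p: "p \<in> ?P" "Suc n \<le> length p" by blast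
    let ?q = "drop (length p - Suc n) p"
    have "?q \<in> ?P"
      using p directed_path_drop[of w p "length p - Suc n"] by auto
    then show "\<exists>p\<in>?P. length p = Suc n"
      by (rule bexI[rotated]) (use p in auto)
  qed
  also have "\<dots> \<longleftrightarrow> (\<exists>p. directed_path w p \<and> length p = Suc n \<and> last p \<in> column_interval ?c ?a ?N)"
    using P by blast
  also have "\<dots> \<longleftrightarrow> survives w n ?c ?a ?N"
    using x by (subst survives_iff_ex_path) (auto simp: even_lattice_def split: prod.splits)
  finally show ?thesis .
qed

section \<open>Binomial sums and the central binomial coefficient\<close>

text \<open>Divided by \<open>4 ^ n\<close>, this is the probability that the walk started from \<open>N\<close> stays positive for \<open>n\<close> steps.
  The reflection principle gives the sum of \<open>(2 * n) choose (n + j)\<close> over \<open>- N < j \<le> N\<close>; the terms for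
  \<open>j = i\<close> and \<open>j = 1 - i\<close> add up to \<open>(2 * n + 1) choose (n + i)\<close>.\<close>

definition upper_binomials :: "nat \<Rightarrow> nat \<Rightarrow> real" where
  "upper_binomials n N = (\<Sum>i = 1..N. real ((2 * n + 1) choose (n + i)))"

lemma upper_binomials_0: "upper_binomials 0 N = of_bool (N > 0)"
proof (cases N)
  case (Suc M)
  then show ?thesis by (induction M arbitrary: N) (simp_all add: upper_binomials_def)
qed (simp add: upper_binomials_def)

text \<open>The one-step equation of the walk. In the induction on \<open>M\<close>, consecutive sums differ by one
  coefficient, and Pascal's rule used twice relates these. The boundary case expresses that the
  walk is stopped at 0; it holds because the two middle coefficients of an odd row are equal.\<close>

lemma upper_binomials_Suc:
  "upper_binomials (Suc n) (Suc M) =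
     upper_binomials n M + 2 * upper_binomials n (Suc M) + upper_binomials n (Suc (Suc M))"
proof (induction M)
  case 0
  have "(2 * n + 1) choose n = (2 * n + 1) choose (n + 1)"
    by (subst binomial_symmetric) auto
  then show ?case by (simp add: upper_binomials_def)
next
  case (Suc M)
  have "upper_binomials m (Suc K) = upper_binomials m K + real ((2 * m + 1) choose (m + K + 1))" for m K
    by (simp add: upper_binomials_def)
  note step = this
  show ?case
    unfolding step[of "Suc n" "Suc M"] Suc.IH step[of n "Suc (Suc M)"] step[of n "Suc M"] step[of n M]
    by simp
qed

text \<open>By the one-step equation, the difference telescopes to the two neighbouring coefficients
  \<open>(2 * n + 1) choose (n + M + 1)\<close> and \<open>(2 * n + 1) choose (n + M + 2)\<close>. Their sum is
  \<open>(2 * n + 2) choose (n + M + 2)\<close>, and absorption gives their shares of it, as in the ballot theorem.\<close>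

lemma upper_binomials_diff:
  "4 * upper_binomials n (Suc M) - upper_binomials (Suc n) (Suc M) =
     real (Suc M) / real (Suc n) * real ((2 * Suc n) choose (Suc n + Suc M))"
proof -
  let ?A = "real ((2 * n + 1) choose (n + M + 1))"
  let ?B = "real ((2 * n + 1) choose (n + M + 2))"
  let ?C = "real ((2 * n + 2) choose (n + M + 2))"
  have "4 * upper_binomials n (Suc M) - upper_binomials (Suc n) (Suc M) = ?A - ?B"
    unfolding upper_binomials_Suc by (simp add: upper_binomials_def)
  moreover have "real (2 * n + 2) * ?A = ?C * real (n + M + 2)"
    using Suc_times_binomial_eq[of "2 * n + 1" "n + M + 1"]
    by (simp only: of_nat_mult[symmetric]) (simp del: binomial_Suc_Suc)
  moreover have "?C = ?A + ?B" by simp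
  ultimately have "real (2 * n + 2) * (?A - ?B) = 2 * real (Suc M) * ?C"
    by (simp add: algebra_simps)
  then have "?A - ?B = real (Suc M) / real (Suc n) * ?C"
    by (simp add: field_simps del: binomial_Suc_Suc)
  with \<open>_ = ?A - ?B\<close> show ?thesis by simp
qed

lemma choose_le_central_binomial: "(2 * n) choose (n + m) \<le> (2 * n) choose n"
  using binomial_maximum'[of n "n + m"] by simp

text \<open>For \<open>m < n\<close>, passing from \<open>m\<close> to \<open>m + 1\<close> multiplies the coefficient by \<open>1 - (2 * m + 1) / (n + m + 1)\<close>. As the coefficient is at most
  the central one \<open>C\<close>, each step loses at most \<open>(2 * m + 1) / n * C\<close>, and the odd numbers add up to a square.
  For \<open>m \<ge> n\<close>, the new lower bound is not positive.\<close>

lemma choose_ge_central_binomial: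
  assumes "n > 0"
  shows "real ((2 * n) choose (n + m)) \<ge> (1 - real m ^ 2 / real n) * real ((2 * n) choose n)"
proof (induction m)
  case (Suc m)
  let ?c = "real ((2 * n) choose n)"
  let ?b = "\<lambda>m. real ((2 * n) choose (n + m))"
  show ?case
  proof (cases "m < n")
    case False
    then have "real (Suc m) ^ 2 \<ge> real n * 1"
      unfolding power2_eq_square using assms by (intro mult_mono) auto
    then have "1 - real (Suc m) ^ 2 / real n \<le> 0" using assms by (simp add: field_simps)
    then have "(1 - real (Suc m) ^ 2 / real n) * ?c \<le> 0"
      by (intro mult_nonpos_nonneg) auto
    then show ?thesis by (meson of_nat_0_le_iff order_trans)
  next
    case True
    have "Suc (n + m) * ((2 * n) choose Suc (n + m)) = (2 * n - (n + m)) * ((2 * n) choose (n + m))"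
      using binomial_absorption[of "n + m" "2 * n"] binomial_absorb_comp[of "2 * n" "n + m"] by simp
    then have "real (Suc (n + m)) * ?b (Suc m) = real (n - m) * ?b m"
      by (simp only: of_nat_mult[symmetric]) simp
    then have eq: "?b (Suc m) = ?b m - real (2 * m + 1) / real (n + m + 1) * ?b m"
      using True by (simp add: field_simps)
    have "real (2 * m + 1) / real (n + m + 1) * ?b m \<le> real (2 * m + 1) / real n * ?c"
      using choose_le_central_binomial[of n m] assms
      by (intro mult_mono divide_left_mono) auto
    with Suc.IH have "?b (Suc m) \<ge> (1 - real m ^ 2 / real n) * ?c - real (2 * m + 1) / real n * ?c"
      unfolding eq by linarith
    also have "(1 - real m ^ 2 / real n) * ?c - real (2 * m + 1) / real n * ?c =
        (1 - real (Suc m) ^ 2 / real n) * ?c"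
      by (simp add: power2_eq_square add_divide_distrib algebra_simps)
    finally show ?thesis .
  qed
qed simp

lemma upper_binomials_le: "upper_binomials n m \<le> 2 * real m * real ((2 * n) choose n)"
proof -
  have "upper_binomials n m \<le> (\<Sum>i = 1..m. 2 * real ((2 * n) choose n))"
    unfolding upper_binomials_def
  proof (rule sum_mono)
    fix i assume "i \<in> {1..m}"
    then obtain j where "i = Suc j" by (cases i) auto
    then show "real ((2 * n + 1) choose (n + i)) \<le> 2 * real ((2 * n) choose n)"
      using choose_le_central_binomial[of n j] choose_le_central_binomial[of n "Suc j"] by simp
  qed
  then show ?thesis by simp
qed

lemma upper_binomials_ge:
  assumes "n > 0"
  shows "upper_binomials n m \<ge> 2 * real m * ((1 - real m ^ 2 / real n) * real ((2 * n) choose n))"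
proof -
  let ?d = "(1 - real m ^ 2 / real n) * real ((2 * n) choose n)"
  have ge: "?d \<le> real ((2 * n) choose (n + j))" if "j \<le> m" for j
  proof -
    have "real j ^ 2 / real n \<le> real m ^ 2 / real n"
      using that by (intro divide_right_mono power_mono) auto
    then have "?d \<le> (1 - real j ^ 2 / real n) * real ((2 * n) choose n)"
      by (intro mult_right_mono) auto
    with choose_ge_central_binomial[OF assms, of j] show ?thesis by linarith
  qed
  have "(\<Sum>i = 1..m. 2 * ?d) \<le> upper_binomials n m"
    unfolding upper_binomials_def
  proof (rule sum_mono)
    fix i assume i: "i \<in> {1..m}"
    then obtain j where "i = Suc j" by (cases i) auto
    then show "2 * ?d \<le> real ((2 * n + 1) choose (n + i))"
      using ge[of j] ge[of "Suc j"] i by simp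
  qed
  then show ?thesis by (simp add: mult_ac)
qed

text \<open>The square of \<open>((2 * n) choose n) / 4 ^ n\<close> is the reciprocal of \<open>2 * n + 1\<close> times the partial Wallis product.\<close>

lemma central_binomial_asymptotic:
  "(\<lambda>n. sqrt (real n) * (real ((2 * n) choose n) / 4 ^ n)) \<longlonglongrightarrow> 1 / sqrt pi"
proof -
  define c where "c n = real ((2 * n) choose n) / 4 ^ n" for n
  have c_Suc: "c (Suc n) = c n * (2 * real n + 1) / (2 * real n + 2)" for n
  proof -
    have alg: "(2 * a * C / b) / (4 * q) = C / q * a / (2 * b)"
      if "b \<noteq> 0" "q \<noteq> 0" for a b q C :: real
      using that by (simp add: field_simps)
    have 1: "Suc n * ((2 * n + 2) choose Suc n) = (2 * n + 2) * ((2 * n + 1) choose n)"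
      using Suc_times_binomial[of n "2 * n + 1"] by (simp del: binomial_Suc_Suc)
    have 2: "Suc n * ((2 * n + 1) choose n) = (2 * n + 1) * ((2 * n) choose n)"
      using binomial_absorb_comp[of "2 * n + 1" n] by (simp del: binomial_Suc_Suc)
    have "real (Suc n) * real ((2 * n + 2) choose Suc n) = real (2 * n + 2) * real ((2 * n + 1) choose n)"
      using 1 by (simp only: of_nat_mult[symmetric])
    moreover have "real (Suc n) * real ((2 * n + 1) choose n) = real (2 * n + 1) * real ((2 * n) choose n)"
      using 2 by (simp only: of_nat_mult[symmetric])
    ultimately have "(real n + 1) * real ((2 * n + 2) choose Suc n) = 2 * (2 * real n + 1) * real ((2 * n) choose n)"
      by (simp add: algebra_simps del: binomial_Suc_Suc)
    then have "real ((2 * n + 2) choose Suc n) = 2 * (2 * real n + 1) * real ((2 * n) choose n) / (real n + 1)"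
      by (simp add: field_simps del: binomial_Suc_Suc)
    then have "c (Suc n) = (2 * (2 * real n + 1) * real ((2 * n) choose n) / (real n + 1)) / (4 * 4 ^ n)"
      by (simp add: c_def del: binomial_Suc_Suc)
    also have "\<dots> = c n * (2 * real n + 1) / (2 * (real n + 1))"
      unfolding c_def by (rule alg) auto
    finally show ?thesis by simp
  qed
  have prod: "c n ^ 2 * (2 * real n + 1) * (\<Prod>k=1..n. (4*real k^2) / (4*real k^2 - 1)) = 1" for n
  proof (induction n)
    case (Suc n)
    have "4 * real (Suc n) ^ 2 - 1 = (2 * real n + 1) * (2 * real n + 3)"
      by (simp add: power2_eq_square algebra_simps)
    then have *: "4 * real (Suc n) ^ 2 / (4 * real (Suc n) ^ 2 - 1) =
        (2 * real n + 2) ^ 2 / ((2 * real n + 1) * (2 * real n + 3))"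
      by (simp add: power2_eq_square algebra_simps)
    let ?P = "\<Prod>k=1..n. (4*real k^2) / (4*real k^2 - 1)"
    have P_Suc: "(\<Prod>k=1..Suc n. (4*real k^2) / (4*real k^2 - 1)) =
        ?P * (4 * real (Suc n) ^ 2 / (4 * real (Suc n) ^ 2 - 1))" by simp
    have e: "2 * real (Suc n) + 1 = 2 * real n + 3" by simp
    have alg: "(d * a / b) ^ 2 * e * (P * (b ^ 2 / (a * e))) = d ^ 2 * a * P"
      if "a > 0" "b > 0" "e > 0" for a b d e P :: real
      using that by (simp add: field_simps power2_eq_square)
    have "c (Suc n) ^ 2 * (2 * real (Suc n) + 1) * (\<Prod>k=1..Suc n. (4*real k^2) / (4*real k^2 - 1)) =
        (c n * (2 * real n + 1) / (2 * real n + 2)) ^ 2 * (2 * real n + 3) *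
          (?P * ((2 * real n + 2) ^ 2 / ((2 * real n + 1) * (2 * real n + 3))))"
      unfolding P_Suc * c_Suc e ..
    also have "\<dots> = c n ^ 2 * (2 * real n + 1) * ?P"
      by (rule alg) auto
    also note Suc.IH
    finally show ?case .
  qed (simp add: c_def)
  define W where "W n = (\<Prod>k=1..n. (4*real k^2) / (4*real k^2 - 1))" for n
  have W: "W \<longlonglongrightarrow> pi / 2" unfolding W_def by (rule wallis)
  have "(\<lambda>n. real n / (2 * real n + 1)) \<longlonglongrightarrow> 1 / 2" by real_asymp
  from tendsto_real_sqrt[OF tendsto_mult[OF this tendsto_inverse[OF W]]]
  have "(\<lambda>n. sqrt (real n / (2 * real n + 1) * inverse (W n))) \<longlonglongrightarrow> sqrt (1 / 2 * inverse (pi / 2))"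
    by simp
  moreover have "sqrt (real n / (2 * real n + 1) * inverse (W n)) = sqrt (real n) * c n" for n
  proof -
    have "W n * (c n ^ 2 * (2 * real n + 1)) = 1"
      using prod[of n] unfolding W_def by (simp only: mult_ac)
    from inverse_unique[OF this]
    have "real n / (2 * real n + 1) * inverse (W n) = real n * c n ^ 2"
      by (simp add: add_nonneg_eq_0_iff)
    then show ?thesis by (simp add: real_sqrt_mult c_def)
  qed
  moreover have "sqrt (1 / 2 * inverse (pi / 2)) = 1 / sqrt pi"
    by (simp add: real_sqrt_divide inverse_eq_divide)
  ultimately show ?thesis by (simp add: c_def)
qed

section \<open>The law of the longest path\<close>

locale fair_environment = prob_space M for M :: "'a measure" +
  fixes \<xi> :: "int \<times> int \<Rightarrow> 'a \<Rightarrow> bool"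
  assumes indep: "indep_vars (\<lambda>_. count_space UNIV) \<xi> even_lattice"
    and fair: "\<And>y. y \<in> even_lattice \<Longrightarrow>
      distr M (count_space UNIV) (\<xi> y) = measure_pmf (bernoulli_pmf (1 / 2))"
begin

definition cylinder :: "(int \<times> int) set \<Rightarrow> (int \<times> int \<Rightarrow> bool) \<Rightarrow> 'a set" where
  "cylinder S v = {\<omega> \<in> space M. \<forall>y\<in>S. \<xi> y \<omega> = v y}"

definition survival :: "nat \<Rightarrow> int \<Rightarrow> int \<Rightarrow> nat \<Rightarrow> 'a set" where
  "survival n c a N = {\<omega> \<in> space M. survives (\<lambda>y. \<xi> y \<omega>) n c a N}"

lemma random_bit: "y \<in> even_lattice \<Longrightarrow> random_variable (count_space UNIV) (\<xi> y)"
  using indep unfolding indep_vars_def by blast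

lemma prob_bit:
  assumes "y \<in> even_lattice"
  shows "prob (\<xi> y -` {b} \<inter> space M) = 1 / 2"
proof -
  have "prob (\<xi> y -` {b} \<inter> space M) = measure (distr M (count_space UNIV) (\<xi> y)) {b}"
    using random_bit[OF assms] by (subst measure_distr) auto
  also have "\<dots> = pmf (bernoulli_pmf (1 / 2)) b"
    using fair[OF assms] by (simp add: pmf.rep_eq)
  also have "\<dots> = 1 / 2" by (cases b) auto
  finally show ?thesis .
qed

lemma cylinder_conv:
  assumes "S \<noteq> {}"
  shows "cylinder S v = (\<Inter>y\<in>S. \<xi> y -` {v y} \<inter> space M)"
  using assms by (auto simp: cylinder_def)

lemma cylinder_events:
  assumes "finite S" "S \<subseteq> even_lattice"
  shows "cylinder S v \<in> events"
proof (cases "S = {}")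
  case True
  then show ?thesis by (simp add: cylinder_def)
next
  case False
  show ?thesis unfolding cylinder_conv[OF False]
    using assms False by (intro sets.finite_INT measurable_sets[OF random_bit]) auto
qed

lemma prob_cylinder:
  assumes "finite S" "S \<subseteq> even_lattice"
  shows "prob (cylinder S v) = (1 / 2) ^ card S"
proof (cases "S = {}")
  case True
  then show ?thesis by (simp add: cylinder_def prob_space)
next
  case False
  have "prob (cylinder S v) = (\<Prod>y\<in>S. prob (\<xi> y -` {v y} \<inter> space M))"
    unfolding cylinder_conv[OF False]
    using assms False by (intro indep_varsD[OF indep]) auto
  also have "\<dots> = (\<Prod>y\<in>S. 1 / 2)"
    using assms by (intro prod.cong prob_bit) auto
  finally show ?thesis by (simp add: power_divide)
qed

text \<open>\<open>survives\<close> from column \<open>c\<close> on reads only nodes to the right of \<open>c\<close>, hence it is independent of the bits in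
  \<open>S\<close>. Carrying an arbitrary cylinder through the induction expresses this independence by means of
  finite products only: the two bits that decide the next step are added to the cylinder, and the
  induction hypothesis is applied to each of their four values.\<close>

lemma cylinder_survival:
  assumes "finite S" "S \<subseteq> even_lattice" "\<forall>y\<in>S. fst y \<le> c" "even (c + a)"
  shows "cylinder S v \<inter> survival n c a N \<in> events \<and>
    prob (cylinder S v \<inter> survival n c a N) =
      (1 / 2) ^ card S * (upper_binomials n N / 4 ^ n)"
  using assms
proof (induction n arbitrary: S v c a N)
  case 0
  have "cylinder S v \<inter> survival 0 c a N = (if N > 0 then cylinder S v else {})"
    by (auto simp: cylinder_def survival_def)
  with 0 show ?case by (simp add: upper_binomials_0 cylinder_events prob_cylinder)
next
  case (Suc n)
  show ?case
  proof (cases N)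
    case 0
    then have "survival (Suc n) c a N = {}" by (simp add: survival_def)
    with 0 show ?thesis by (simp add: upper_binomials_def)
  next
    case N: (Suc K)
    \<comment> \<open>The two nodes whose bits decide the next step; they differ since \<open>N > 0\<close>.\<close>
    define p where "p = (c + 1, a - 1)"
    define q where "q = (c + 1, a + 2 * int N - 1)"
    have pq: "p \<noteq> q" "p \<notin> S" "q \<notin> S" "p \<in> even_lattice" "q \<in> even_lattice"
      using Suc.prems by (auto simp: p_def q_def N even_lattice_def)
    let ?S = "insert p (insert q S)"
    define E where "E = (\<lambda>(b, b'). cylinder ?S (v(p := b, q := b')) \<inter>
      survival n (c + 1) (if b then a - 1 else a + 1) (N - 1 + of_bool b + of_bool (\<not> b')))"
    have IH: "E (b, b') \<in> events \<and> prob (E (b, b')) =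
        (1 / 2) ^ (card S + 2) * (upper_binomials n (N - 1 + of_bool b + of_bool (\<not> b')) / 4 ^ n)" for b b'
    proof -
      have card: "card ?S = card S + 2" using pq Suc.prems(1) by simp
      have "finite ?S" "?S \<subseteq> even_lattice" "\<forall>y\<in>?S. fst y \<le> c + 1"
        "even (c + 1 + (if b then a - 1 else a + 1))"
        using Suc.prems pq by (auto simp: p_def q_def)
      from Suc.IH[OF this] show ?thesis
        by (simp only: E_def prod.case card simp_thms)
    qed
    have union: "cylinder S v \<inter> survival (Suc n) c a N = (\<Union>bb\<in>UNIV. E bb)"
    proof (intro equalityI subsetI)
      fix \<omega> assume \<omega>: "\<omega> \<in> cylinder S v \<inter> survival (Suc n) c a N"
      then have "\<omega> \<in> E (\<xi> p \<omega>, \<xi> q \<omega>)"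
        using pq by (auto simp: E_def cylinder_def survival_def p_def q_def)
      then show "\<omega> \<in> (\<Union>bb\<in>UNIV. E bb)" by blast
    next
      fix \<omega> assume "\<omega> \<in> (\<Union>bb\<in>UNIV. E bb)"
      then obtain b b' where \<omega>: "\<omega> \<in> E (b, b')" by auto
      then have "\<xi> p \<omega> = b" "\<xi> q \<omega> = b'"
        using pq by (auto simp: E_def cylinder_def)
      moreover have "\<forall>y\<in>S. \<xi> y \<omega> = v y"
        using \<omega> pq by (auto simp: E_def cylinder_def split: if_splits)
      ultimately show "\<omega> \<in> cylinder S v \<inter> survival (Suc n) c a N"
        using \<omega> by (simp add: E_def cylinder_def survival_def p_def q_def N)
    qed
    have disj: "disjoint_family_on E UNIV"
      using pq by (auto simp: disjoint_family_on_def E_def cylinder_def)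
    have ev: "E bb \<in> events" for bb using IH by (cases bb) auto
    have "prob (\<Union>bb\<in>UNIV. E bb) = (\<Sum>bb\<in>UNIV. prob (E bb))"
      using disj ev by (intro finite_measure_finite_Union) auto
    also have "\<dots> = prob (E (True, False)) + prob (E (True, True)) + prob (E (False, False)) +
        prob (E (False, True))"
      by (simp add: UNIV_Times_UNIV[symmetric] sum.cartesian_product[symmetric] UNIV_bool
          del: UNIV_Times_UNIV)
    also have "\<dots> = (1 / 2) ^ card S * (upper_binomials (Suc n) N / 4 ^ Suc n)"
      using IH by (simp add: N upper_binomials_Suc field_simps)
    finally show ?thesis using ev union by auto
  qed
qed

lemma survival_events: "even (c + a) \<Longrightarrow> survival n c a N \<in> events"
  and prob_survival: "even (c + a) \<Longrightarrow> prob (survival n c a N) = upper_binomials n N / 4 ^ n"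
proof -
  have "cylinder {} (\<lambda>_. True) \<inter> survival n c a N = survival n c a N"
    by (auto simp: cylinder_def survival_def)
  then show "even (c + a) \<Longrightarrow> survival n c a N \<in> events"
    "even (c + a) \<Longrightarrow> prob (survival n c a N) = upper_binomials n N / 4 ^ n"
    using cylinder_survival[of "{}" c a "\<lambda>_. True" n N] by auto
qed

lemma
  assumes "x \<in> even_lattice" "l > 0"
  shows tau_ge_events: "{\<omega> \<in> space M. enat (Suc n) \<le> tau l x (\<lambda>y. \<xi> y \<omega>)} \<in> events"
    and prob_tau_ge: "prob {\<omega> \<in> space M. enat (Suc n) \<le> tau l x (\<lambda>y. \<xi> y \<omega>)} =
      upper_binomials n (2 * nat \<lfloor>l / 4\<rfloor> + 1) / 4 ^ n"
proof -
  have "even (fst x + (snd x - 2 * \<lfloor>l / 4\<rfloor>))"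
    using assms by (auto simp: even_lattice_def)
  note survival_events[OF this] prob_survival[OF this]
  then show "{\<omega> \<in> space M. enat (Suc n) \<le> tau l x (\<lambda>y. \<xi> y \<omega>)} \<in> events"
    "prob {\<omega> \<in> space M. enat (Suc n) \<le> tau l x (\<lambda>y. \<xi> y \<omega>)} =
      upper_binomials n (2 * nat \<lfloor>l / 4\<rfloor> + 1) / 4 ^ n"
    unfolding tau_ge_iff_survives[OF assms] survival_def by blast+
qed

lemma prob_tau_eq:
  assumes "x \<in> even_lattice" "l > 0" "n > 0"
  defines "m \<equiv> 2 * nat \<lfloor>l / 4\<rfloor> + 1"
  shows "prob {\<omega> \<in> space M. tau l x (\<lambda>y. \<xi> y \<omega>) = enat n} =
    real m / real n * real ((2 * n) choose (n + m)) / 4 ^ n"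
proof -
  obtain k where n: "n = Suc k" using \<open>n > 0\<close> by (cases n) auto
  obtain K where m: "m = Suc K" by (simp add: m_def)
  let ?T = "\<lambda>k. {\<omega> \<in> space M. enat k \<le> tau l x (\<lambda>y. \<xi> y \<omega>)}"
  have eq_iff: "t = enat n \<longleftrightarrow> enat n \<le> t \<and> \<not> enat (Suc n) \<le> t" for t
    by (cases t) auto
  have "{\<omega> \<in> space M. tau l x (\<lambda>y. \<xi> y \<omega>) = enat n} = ?T n - ?T (Suc n)"
    by (subst eq_iff) blast
  moreover have "?T (Suc n) \<subseteq> ?T n"
  proof safe
    fix \<omega> assume "enat (Suc n) \<le> tau l x (\<lambda>y. \<xi> y \<omega>)"
    then show "enat n \<le> tau l x (\<lambda>y. \<xi> y \<omega>)"
      by (rule order_trans[rotated]) simp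
  qed
  ultimately have "prob {\<omega> \<in> space M. tau l x (\<lambda>y. \<xi> y \<omega>) = enat n} =
      prob (?T n) - prob (?T (Suc n))"
    using tau_ge_events[OF assms(1,2)] by (simp add: finite_measure_Diff n)
  also have "\<dots> = upper_binomials k m / 4 ^ k - upper_binomials (Suc k) m / 4 ^ Suc k"
    unfolding n prob_tau_ge[OF assms(1,2)] m_def ..
  also have "\<dots> = (4 * upper_binomials k m - upper_binomials (Suc k) m) / 4 ^ Suc k"
    by (simp add: field_simps)
  also have "\<dots> = real m / real n * real ((2 * n) choose (n + m)) / 4 ^ n"
    unfolding m n upper_binomials_diff ..
  finally show ?thesis .
qed

end

section \<open>Slit lengths well below the square root of the path length\<close>

text \<open>For arbitrary real \<open>l\<close> the number of nodes on the slit is \<open>l / 2\<close> up to a bounded error.\<close>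

lemma slit_nodes_asymptotic:
  "((\<lambda>l. real (2 * nat \<lfloor>l / 4\<rfloor> + 1) / l) \<longlongrightarrow> 1 / 2) at_top"
proof (rule tendsto_sandwich)
  show "\<forall>\<^sub>F l in at_top. (l / 2 - 1) / l \<le> real (2 * nat \<lfloor>l / 4\<rfloor> + 1) / l"
    using eventually_gt_at_top[of 0]
  proof eventually_elim
    case (elim l)
    have "real (nat \<lfloor>l / 4\<rfloor>) = real_of_int \<lfloor>l / 4\<rfloor>" using elim by simp
    with elim show ?case by (intro divide_right_mono) linarith+
  qed
  show "\<forall>\<^sub>F l in at_top. real (2 * nat \<lfloor>l / 4\<rfloor> + 1) / l \<le> (l / 2 + 1) / l"
    using eventually_gt_at_top[of 0]
  proof eventually_elim
    case (elim l)
    have "real (nat \<lfloor>l / 4\<rfloor>) = real_of_int \<lfloor>l / 4\<rfloor>" using elim by simp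
    with elim show ?case by (intro divide_right_mono) linarith+
  qed
  show "((\<lambda>l :: real. (l / 2 - 1) / l) \<longlongrightarrow> 1 / 2) at_top" by real_asymp
  show "((\<lambda>l :: real. (l / 2 + 1) / l) \<longlongrightarrow> 1 / 2) at_top" by real_asymp
qed

text \<open>The two limits concern the times \<open>nat \<lfloor>f l\<rfloor>\<close> and \<open>nat (\<lceil>f l\<rceil> - 1)\<close>, which differ by rounding. This locale keeps
  only what both share: \<open>n\<close> is asymptotic to \<open>f\<close>, and the starting point \<open>m\<close> of the walk to \<open>l / 2\<close>.\<close>

locale diffusive_regime =
  fixes f :: "real \<Rightarrow> real" and n m :: "real \<Rightarrow> nat"
  assumes f_pos: "\<forall>\<^sub>F l in at_top. f l > 0"
    and f_growth: "((\<lambda>l. l\<^sup>2 / f l) \<longlongrightarrow> 0) at_top"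
    and n_f: "((\<lambda>l. real (n l) / f l) \<longlongrightarrow> 1) at_top"
    and m_l: "((\<lambda>l. real (m l) / l) \<longlongrightarrow> 1 / 2) at_top"

lemma superquadratic_at_top:
  fixes f :: "real \<Rightarrow> real"
  assumes f_pos: "\<forall>\<^sub>F l in at_top. f l > 0"
    and f_growth: "((\<lambda>l. l\<^sup>2 / f l) \<longlongrightarrow> 0) at_top"
  shows "filterlim f at_top at_top"
proof (rule filterlim_at_top_mono)
  show "filterlim (\<lambda>l :: real. l\<^sup>2) at_top at_top" by real_asymp
  have "\<forall>\<^sub>F l in at_top. l\<^sup>2 / f l < 1"
    using order_tendstoD(2)[OF f_growth, of 1] by simp
  with f_pos show "\<forall>\<^sub>F l in at_top. l\<^sup>2 \<le> f l"
    by eventually_elim (simp add: field_simps)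
qed

context diffusive_regime
begin

lemma f_at_top: "filterlim f at_top at_top"
  by (rule superquadratic_at_top[OF f_pos f_growth])

lemma n_at_top: "filterlim n at_top at_top"
proof -
  have "filterlim (\<lambda>l. real (n l) / f l * f l) at_top at_top"
    by (rule filterlim_tendsto_pos_mult_at_top[OF n_f _ f_at_top]) simp
  moreover have "\<forall>\<^sub>F l in at_top. real (n l) / f l * f l = real (n l)"
    using f_pos by eventually_elim simp
  ultimately have "filterlim (\<lambda>l. real (n l)) at_top at_top"
    using filterlim_cong[OF refl refl] by fast
  then show ?thesis by (simp add: filterlim_sequentially_iff_filterlim_real)
qed

lemma f_n: "((\<lambda>l. f l / real (n l)) \<longlongrightarrow> 1) at_top"
  using tendsto_inverse[OF n_f] by (simp add: inverse_eq_divide)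

lemma eventually_pos: "\<forall>\<^sub>F l in at_top. l > 0 \<and> f l > 0 \<and> n l > 0 \<and> m l > 0"
proof -
  have "\<forall>\<^sub>F l in at_top. real (m l) / l > 0"
    using order_tendstoD(1)[OF m_l, of 0] by simp
  moreover have "\<forall>\<^sub>F l in at_top. n l \<ge> 1"
    using n_at_top by (simp add: filterlim_at_top)
  ultimately show ?thesis
    using f_pos eventually_gt_at_top[of 0]
    by eventually_elim (auto simp: zero_less_divide_iff)
qed

text \<open>The comparison of the binomial coefficients with the central one becomes sharp, since
  \<open>m\<^sup>2 / n = (m / l)\<^sup>2 * (l\<^sup>2 / f l) * (f l / n)\<close> tends to 0.\<close>

lemma m_sq_n: "((\<lambda>l. 1 - real (m l) ^ 2 / real (n l)) \<longlongrightarrow> 1) at_top"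
proof -
  have lim: "((\<lambda>l. 1 - (real (m l) / l) ^ 2 * (l\<^sup>2 / f l) * (f l / real (n l))) \<longlongrightarrow>
      1 - (1 / 2) ^ 2 * 0 * 1) at_top"
    by (intro tendsto_intros m_l f_growth f_n)
  have "\<forall>\<^sub>F l in at_top. 1 - (real (m l) / l) ^ 2 * (l\<^sup>2 / f l) * (f l / real (n l)) =
      1 - real (m l) ^ 2 / real (n l)"
    using eventually_pos by eventually_elim (simp add: field_simps)
  from Lim_transform_eventually[OF lim this] show ?thesis by simp
qed

lemma central: "((\<lambda>l. sqrt (real (n l)) * (real ((2 * n l) choose n l) / 4 ^ n l)) \<longlongrightarrow> 1 / sqrt pi) at_top"
  by (rule filterlim_compose[OF central_binomial_asymptotic n_at_top])

lemma local_limit: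
  "((\<lambda>l. f l powr (3 / 2) / l *
      (real (m l) / real (n l) * real ((2 * n l) choose (n l + m l)) / 4 ^ n l))
    \<longlongrightarrow> 1 / (2 * sqrt pi)) at_top"
proof -
  have ratio: "((\<lambda>l. real ((2 * n l) choose (n l + m l)) / real ((2 * n l) choose n l)) \<longlongrightarrow> 1) at_top"
  proof (rule tendsto_sandwich[OF _ _ m_sq_n tendsto_const])
    show "\<forall>\<^sub>F l in at_top. 1 - real (m l) ^ 2 / real (n l) \<le>
        real ((2 * n l) choose (n l + m l)) / real ((2 * n l) choose n l)"
      using eventually_pos
      by eventually_elim (use choose_ge_central_binomial in \<open>simp add: pos_le_divide_eq\<close>)
    show "\<forall>\<^sub>F l in at_top. real ((2 * n l) choose (n l + m l)) / real ((2 * n l) choose n l) \<le> 1"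
      using choose_le_central_binomial by (intro always_eventually) (simp add: divide_le_eq_1)
  qed
  have lim: "((\<lambda>l. (f l / real (n l)) powr (3 / 2) * (real (m l) / l) *
      (sqrt (real (n l)) * (real ((2 * n l) choose n l) / 4 ^ n l)) *
      (real ((2 * n l) choose (n l + m l)) / real ((2 * n l) choose n l)))
    \<longlongrightarrow> 1 powr (3 / 2) * (1 / 2) * (1 / sqrt pi) * 1) at_top"
    by (intro tendsto_mult tendsto_powr f_n m_l central ratio tendsto_const) auto
  have "\<forall>\<^sub>F l in at_top. (f l / real (n l)) powr (3 / 2) * (real (m l) / l) *
      (sqrt (real (n l)) * (real ((2 * n l) choose n l) / 4 ^ n l)) *
      (real ((2 * n l) choose (n l + m l)) / real ((2 * n l) choose n l)) =
    f l powr (3 / 2) / l *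
      (real (m l) / real (n l) * real ((2 * n l) choose (n l + m l)) / 4 ^ n l)"
    using eventually_pos
  proof eventually_elim
    case (elim l)
    have "real (n l) powr (3 / 2) = real (n l) powr (1 + 1 / 2)" by simp
    also have "\<dots> = real (n l) * sqrt (real (n l))"
      using elim by (subst powr_add) (simp add: powr_half_sqrt)
    finally have "(f l / real (n l)) powr (3 / 2) = f l powr (3 / 2) / (real (n l) * sqrt (real (n l)))"
      using elim by (simp add: powr_divide)
    then show ?case using elim by simp
  qed
  from Lim_transform_eventually[OF lim this] show ?thesis by simp
qed

lemma tail_limit:
  "((\<lambda>l. sqrt (f l) / l * (upper_binomials (n l) (m l) / 4 ^ n l)) \<longlongrightarrow> 1 / sqrt pi) at_top"
proof -
  let ?d = "\<lambda>l. 2 * real (m l) * real ((2 * n l) choose n l)"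
  have ratio: "((\<lambda>l. upper_binomials (n l) (m l) / ?d l) \<longlongrightarrow> 1) at_top"
  proof (rule tendsto_sandwich[OF _ _ m_sq_n tendsto_const])
    show "\<forall>\<^sub>F l in at_top. 1 - real (m l) ^ 2 / real (n l) \<le> upper_binomials (n l) (m l) / ?d l"
      using eventually_pos
    proof eventually_elim
      case (elim l)
      then have "?d l > 0" by simp
      with upper_binomials_ge[of "n l" "m l"] elim show ?case
        by (simp only: pos_le_divide_eq) (simp add: mult_ac)
    qed
    show "\<forall>\<^sub>F l in at_top. upper_binomials (n l) (m l) / ?d l \<le> 1"
      using eventually_pos
    proof eventually_elim
      case (elim l)
      then have "?d l > 0" by simp
      with upper_binomials_le[of "n l" "m l"] show ?case
        by (simp only: pos_divide_le_eq mult_1)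
    qed
  qed
  have lim: "((\<lambda>l. sqrt (f l / real (n l)) * (2 * (real (m l) / l)) *
      (sqrt (real (n l)) * (real ((2 * n l) choose n l) / 4 ^ n l)) *
      (upper_binomials (n l) (m l) / ?d l))
    \<longlongrightarrow> sqrt 1 * (2 * (1 / 2)) * (1 / sqrt pi) * 1) at_top"
    by (intro tendsto_mult tendsto_real_sqrt f_n m_l central ratio tendsto_const)
  have "\<forall>\<^sub>F l in at_top. sqrt (f l / real (n l)) * (2 * (real (m l) / l)) *
      (sqrt (real (n l)) * (real ((2 * n l) choose n l) / 4 ^ n l)) *
      (upper_binomials (n l) (m l) / ?d l) =
      sqrt (f l) / l * (upper_binomials (n l) (m l) / 4 ^ n l)"
    using eventually_pos by eventually_elim (simp add: real_sqrt_divide)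
  from Lim_transform_eventually[OF lim this] show ?thesis by simp
qed

end

lemma floor_ratio_tendsto:
  fixes f :: "real \<Rightarrow> real" and n :: "real \<Rightarrow> nat"
  assumes f: "filterlim f at_top at_top"
    and n: "\<forall>\<^sub>F l in at_top. \<bar>real (n l) - f l\<bar> \<le> 1"
  shows "((\<lambda>l. real (n l) / f l) \<longlongrightarrow> 1) at_top"
proof (rule tendsto_sandwich)
  have pos: "\<forall>\<^sub>F l in at_top. f l > 0" using f by (simp add: filterlim_at_top_dense)
  show "\<forall>\<^sub>F l in at_top. (f l - 1) / f l \<le> real (n l) / f l"
    using pos n by eventually_elim (intro divide_right_mono; linarith)
  show "\<forall>\<^sub>F l in at_top. real (n l) / f l \<le> (f l + 1) / f l"
    using pos n by eventually_elim (intro divide_right_mono; linarith)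
  have "((\<lambda>y :: real. (y - 1) / y) \<longlongrightarrow> 1) at_top" by real_asymp
  from filterlim_compose[OF this f] show "((\<lambda>l. (f l - 1) / f l) \<longlongrightarrow> 1) at_top" .
  have "((\<lambda>y :: real. (y + 1) / y) \<longlongrightarrow> 1) at_top" by real_asymp
  from filterlim_compose[OF this f] show "((\<lambda>l. (f l + 1) / f l) \<longlongrightarrow> 1) at_top" .
qed

text \<open>As \<open>t\<close> is an integer or infinite, the condition is \<open>\<lceil>r\<rceil> \<le> t\<close>; writing \<open>\<lceil>r\<rceil>\<close> as a successor matches
  \<open>prob_tau_ge\<close>.\<close>

lemma ereal_of_enat_ge_iff:
  assumes "r > 0"
  shows "ereal_of_enat t \<ge> ereal r \<longleftrightarrow> enat (Suc (nat (\<lceil>r\<rceil> - 1))) \<le> t"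
proof (cases t)
  case (enat k)
  have "r \<le> real k \<longleftrightarrow> \<lceil>r\<rceil> \<le> int k" by (simp add: ceiling_le_iff)
  also have "\<dots> \<longleftrightarrow> Suc (nat (\<lceil>r\<rceil> - 1)) \<le> k" using assms by linarith
  finally show ?thesis by (simp add: enat)
qed simp

theorem theorem1p2:
  fixes M :: "'a measure"
    and \<xi> :: "int \<times> int \<Rightarrow> 'a \<Rightarrow> bool"
    and x :: "int \<times> int"
  assumes "prob_space M"
    and "prob_space.indep_vars M (\<lambda>_. count_space UNIV) \<xi> even_lattice"
    and "\<And>y. y \<in> even_lattice \<Longrightarrow>
           distr M (count_space UNIV) (\<xi> y) = measure_pmf (bernoulli_pmf (1 / 2))"
    and "x \<in> even_lattice"
  shows "(\<forall>l n :: nat. l mod 4 = 2 \<longrightarrow> n \<ge> 1 \<longrightarrow>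
            measure M {\<omega> \<in> space M. tau (real l) x (\<lambda>y. \<xi> y \<omega>) = enat n}
              = real l / (2 * real n) * real ((2 * n) choose (n + l div 2)) * (1 / 4 ^ n))
       \<and> (\<forall>f :: real \<Rightarrow> real.
            (\<forall>\<^sub>F l in at_top. f l > 0) \<longrightarrow>
            ((\<lambda>l. l\<^sup>2 / f l) \<longlongrightarrow> 0) at_top \<longrightarrow>
            ((\<lambda>l. f l powr (3 / 2) / l *
                measure M {\<omega> \<in> space M. tau l x (\<lambda>y. \<xi> y \<omega>) = enat (nat \<lfloor>f l\<rfloor>)})
              \<longlongrightarrow> 1 / (2 * sqrt pi)) at_top
          \<and> ((\<lambda>l. sqrt (f l) / l *
                measure M {\<omega> \<in> space M. ereal_of_enat (tau l x (\<lambda>y. \<xi> y \<omega>)) \<ge> ereal (f l)})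
              \<longlongrightarrow> 1 / sqrt pi) at_top)"
proof -
  interpret prob_space M by fact
  interpret fair_environment M \<xi>
    by unfold_locales (use assms in auto)
  show ?thesis
  proof (intro conjI allI impI)
    fix l n :: nat
    assume l: "l mod 4 = 2" and n: "n \<ge> 1"
    have "\<lfloor>real l / 4\<rfloor> = int (l div 4)" using floor_divide_of_nat_eq[of l 4] by simp
    moreover have half: "l = 2 * (2 * (l div 4) + 1)" using l by presburger
    ultimately have m: "2 * nat \<lfloor>real l / 4\<rfloor> + 1 = l div 2" by simp
    have "l > 0" using l by (intro Nat.gr0I) simp
    moreover obtain K where K: "l = 2 * K" using half by blast
    ultimately show "prob {\<omega> \<in> space M. tau (real l) x (\<lambda>y. \<xi> y \<omega>) = enat n}
        = real l / (2 * real n) * real ((2 * n) choose (n + l div 2)) * (1 / 4 ^ n)"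
      using prob_tau_eq[OF assms(4), of "real l" n] n unfolding m unfolding K by simp
  next
    fix f :: "real \<Rightarrow> real"
    assume f: "\<forall>\<^sub>F l in at_top. f l > 0" "((\<lambda>l. l\<^sup>2 / f l) \<longlongrightarrow> 0) at_top"
    note top = superquadratic_at_top[OF f]
    define n where "n l = nat \<lfloor>f l\<rfloor>" for l
    have "\<forall>\<^sub>F l in at_top. \<bar>real (n l) - f l\<bar> \<le> 1"
      using f(1) by eventually_elim (simp add: n_def, linarith)
    from floor_ratio_tendsto[OF top this]
    interpret diffusive_regime f n "\<lambda>l. 2 * nat \<lfloor>l / 4\<rfloor> + 1"
      by unfold_locales (use f slit_nodes_asymptotic in auto)
    have "\<forall>\<^sub>F l in at_top. f l powr (3 / 2) / l *
          (real (2 * nat \<lfloor>l / 4\<rfloor> + 1) / real (n l) *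
            real ((2 * n l) choose (n l + (2 * nat \<lfloor>l / 4\<rfloor> + 1))) / 4 ^ n l) =
        f l powr (3 / 2) / l * prob {\<omega> \<in> space M. tau l x (\<lambda>y. \<xi> y \<omega>) = enat (nat \<lfloor>f l\<rfloor>)}"
      using eventually_pos
      by eventually_elim (simp only: prob_tau_eq[OF assms(4)] flip: n_def)
    from Lim_transform_eventually[OF local_limit this]
    show "((\<lambda>l. f l powr (3 / 2) / l *
          prob {\<omega> \<in> space M. tau l x (\<lambda>y. \<xi> y \<omega>) = enat (nat \<lfloor>f l\<rfloor>)})
        \<longlongrightarrow> 1 / (2 * sqrt pi)) at_top" .
  next
    fix f :: "real \<Rightarrow> real"
    assume f: "\<forall>\<^sub>F l in at_top. f l > 0" "((\<lambda>l. l\<^sup>2 / f l) \<longlongrightarrow> 0) at_top"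
    note top = superquadratic_at_top[OF f]
    define n where "n l = nat (\<lceil>f l\<rceil> - 1)" for l
    have "\<forall>\<^sub>F l in at_top. \<bar>real (n l) - f l\<bar> \<le> 1"
      using f(1)
    proof eventually_elim
      case (elim l)
      then have "real (n l) = real_of_int \<lceil>f l\<rceil> - 1" by (simp add: n_def)
      then show ?case by linarith
    qed
    from floor_ratio_tendsto[OF top this]
    interpret diffusive_regime f n "\<lambda>l. 2 * nat \<lfloor>l / 4\<rfloor> + 1"
      by unfold_locales (use f slit_nodes_asymptotic in auto)
    have "\<forall>\<^sub>F l in at_top. sqrt (f l) / l *
          (upper_binomials (n l) (2 * nat \<lfloor>l / 4\<rfloor> + 1) / 4 ^ n l) =
        sqrt (f l) / l *
          prob {\<omega> \<in> space M. ereal_of_enat (tau l x (\<lambda>y. \<xi> y \<omega>)) \<ge> ereal (f l)}"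
      using eventually_pos
      by eventually_elim (simp only: ereal_of_enat_ge_iff prob_tau_ge[OF assms(4)] flip: n_def)
    from Lim_transform_eventually[OF tail_limit this]
    show "((\<lambda>l. sqrt (f l) / l *
          prob {\<omega> \<in> space M. ereal_of_enat (tau l x (\<lambda>y. \<xi> y \<omega>)) \<ge> ereal (f l)})
        \<longlongrightarrow> 1 / sqrt pi) at_top" .
  qed
qed

end
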